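(* Let $G$ be a connected graph with diameter $2$. Then $vcfc(G)=2$ and $cfc(G)=\max\{2,h(G)\}$.
   Context: All graphs are simple, finite and undirected. In an edge-colored (respectively vertex-colored) graph, where colorings are arbitrary and not required to be proper, a path is called conflict-free if there is a color used on exactly one of its edges (respectively vertices). The colored graph is conflict-free connected (respectively conflict-free vertex-connected) if every pair of distinct vertices is connected by a conflict-free path. For a connected graph $G$, the conflict-free connection number $cfc(G)$ (respectively conflict-free vertex-connection number $vcfc(G)$) is the smallest number of colors in an edge-coloring (respectively vertex-coloring) that makes $G$ conflict-free connected (respectively conflict-free vertex-connected). For a connected graph $G$, let $C(G)$ be the subgraph of $G$ induced by the set of cut-edges (bridges) of $G$, that is, the subgraph consisting of all cut-edges and their end-vertices; it is a forest. Define $h(G)=\max\{cfc(T): T \text{ is a component of } C(G)\}$, with $h(G)=0$ if $G$ has no cut-edge. *)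

theory Defs
  imports "Graph_Theory.Graph_Theory"
begin

text \<open>
  A finite simple undirected graph is an instance of the library locale \<open>graph\<close>: a finite
  symmetric digraph without loops and parallel arcs. An undirected edge is a pair of mutually
  inverse arcs; it is represented here by the set of its two end-vertices, so that an
  edge-coloring cannot distinguish the two directions.
\<close>

definition arc_edge :: "('a, 'b) pre_digraph \<Rightarrow> 'b \<Rightarrow> 'a set" where
  "arc_edge G a = {tail G a, head G a}"

definition edges :: "('a, 'b) pre_digraph \<Rightarrow> 'a set set" where
  "edges G = arc_edge G ` arcs G"

text \<open>
  The library's path distance \<open>\<mu>\<close> with all arc weights equal to 1 is the usual graph distance.
  The supremum is a maximum for nonempty finite graphs.
\<close>

definition diameter :: "('a, 'b) pre_digraph \<Rightarrow> ereal" where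
  "diameter G = (SUP u\<in>verts G. SUP v\<in>verts G. wf_digraph.\<mu> G (\<lambda>_. 1) u v)"

subsection \<open>Conflict-free connection\<close>

definition conflict_free :: "('c \<Rightarrow> nat) \<Rightarrow> 'c set \<Rightarrow> bool" where
  "conflict_free c X \<longleftrightarrow> (\<exists>k. \<exists>!x. x \<in> X \<and> c x = k)"

definition cf_connected :: "('a, 'b) pre_digraph \<Rightarrow> ('a set \<Rightarrow> nat) \<Rightarrow> bool" where
  "cf_connected G c \<longleftrightarrow> (\<forall>u\<in>verts G. \<forall>v\<in>verts G. u \<noteq> v \<longrightarrow>
     (\<exists>p. pre_digraph.apath G u p v \<and> conflict_free c (arc_edge G ` set p)))"

definition cf_vertex_connected :: "('a, 'b) pre_digraph \<Rightarrow> ('a \<Rightarrow> nat) \<Rightarrow> bool" where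
  "cf_vertex_connected G c \<longleftrightarrow> (\<forall>u\<in>verts G. \<forall>v\<in>verts G. u \<noteq> v \<longrightarrow>
     (\<exists>p. pre_digraph.apath G u p v \<and>
          conflict_free c (set (pre_digraph.awalk_verts G u p))))"

text \<open>
  For disconnected graphs the following two numbers are unspecified; for a single vertex they
  are 0 and 1.
\<close>

definition cfc :: "('a, 'b) pre_digraph \<Rightarrow> nat" where
  "cfc G = (LEAST k. \<exists>c. c ` edges G \<subseteq> {..<k} \<and> cf_connected G c)"

definition vcfc :: "('a, 'b) pre_digraph \<Rightarrow> nat" where
  "vcfc G = (LEAST k. \<exists>c. c ` verts G \<subseteq> {..<k} \<and> cf_vertex_connected G c)"

subsection \<open>Cut-edges\<close>

definition delete_edge :: "('a, 'b) pre_digraph \<Rightarrow> 'a set \<Rightarrow> ('a, 'b) pre_digraph" where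
  "delete_edge G e = G\<lparr>arcs := {a \<in> arcs G. arc_edge G a \<noteq> e}\<rparr>"

text \<open>The following is the notion of a cut-edge for connected graphs only.\<close>

definition cut_edges :: "('a, 'b) pre_digraph \<Rightarrow> 'a set set" where
  "cut_edges G = {e \<in> edges G. \<not> Digraph_Component.connected (delete_edge G e)}"

definition cut_edge_subgraph :: "('a, 'b) pre_digraph \<Rightarrow> ('a, 'b) pre_digraph" where
  "cut_edge_subgraph G =
     G\<lparr>verts := \<Union>(cut_edges G), arcs := {a \<in> arcs G. arc_edge G a \<in> cut_edges G}\<rparr>"

text \<open>
  In a symmetric digraph the strongly connected components \<open>sccs\<close> are the components of the
  undirected graph.
\<close>

definition cut_edge_cfc :: "('a, 'b) pre_digraph \<Rightarrow> nat" where
  "cut_edge_cfc G =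
     (if cut_edges G = {} then 0
      else Max (cfc ` pre_digraph.sccs (cut_edge_subgraph G)))"

end

theory Submission
  imports Defs
begin

text \<open>
  If no vertex of a graph of diameter two is adjacent to all others, then the graph has no
  cut-vertex and no cut-edge, so between any two vertices there are a path through any given
  vertex and a path through any given edge; coloring one vertex or one edge differently from the
  rest suffices. If \<open>v\<close> is adjacent to all other vertices, then giving \<open>v\<close> a color of its own
  settles the vertex version. In this case the cut-edges are the pendant edges at \<open>v\<close>. They form a
  star, and as the path between two leaves is unique, they need distinct colors. A coloring
  that meets this bound (and uses at least two colors) gives color 0 to the other edges at \<open>v\<close>
  and color 1 to the edges that avoid \<open>v\<close>. The same bounds apply to the star itself, which
  identifies the number of leaves with \<open>cut_edge_cfc G\<close>, up to the maximum with 2.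
\<close>

unbundle no funcset_syntax

section \<open>Walks, paths and their edges in terms of vertex lists\<close>

text \<open>Unordered pairs match \<open>arc_edge\<close> and make the set invariant under reversal
  of the list.\<close>

definition vwalk_edges :: "'a list \<Rightarrow> 'a set set" where
  "vwalk_edges p = (\<lambda>(x, y). {x, y}) ` set (vwalk_arcs p)"

lemma vwalk_edges_simps [simp]:
  "vwalk_edges [] = {}"
  "vwalk_edges [x] = {}"
  "vwalk_edges (x # y # p) = insert {x, y} (vwalk_edges (y # p))"
  by (simp_all add: vwalk_edges_def)

lemma vwalk_edges_rev [simp]: "vwalk_edges (rev p) = vwalk_edges p"
  unfolding vwalk_edges_def set_vwalk_arcs_rev by (auto simp: image_iff insert_commute)

lemma consecutive_in_vwalk_edges: "{x, y} \<in> vwalk_edges (xs @ x # y # ys)"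
proof (induction xs)
  case (Cons a xs)
  then show ?case by (cases xs) auto
qed simp

text \<open>With \<open>successively\<close>, cutting and splicing of walks reduces to rules for
  append and cons.\<close>

lemma vwalk_conv_successively:
  "vwalk p G \<longleftrightarrow> p \<noteq> [] \<and> set p \<subseteq> verts G \<and> successively (dominates G) p"
proof -
  have "set (vwalk_arcs p) \<subseteq> arcs_ends G \<longleftrightarrow> successively (dominates G) p"
    by (induction p rule: vwalk_arcs.induct) auto
  then show ?thesis by (auto simp: vwalk_def)
qed

lemma conflict_freeI:
  assumes "x \<in> X" "\<And>y. y \<in> X \<Longrightarrow> c y = c x \<Longrightarrow> y = x"
  shows "conflict_free c X"
  unfolding conflict_free_def using assms by (intro exI[of _ "c x"]) blast

text \<open>Without parallel arcs the vertex list determines the path, and vertex lists are easier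
  to splice than arc lists.\<close>

definition vpath_between :: "('a, 'b) pre_digraph \<Rightarrow> 'a \<Rightarrow> 'a list \<Rightarrow> 'a \<Rightarrow> bool" where
  "vpath_between G u p v \<longleftrightarrow> vpath p G \<and> hd p = u \<and> last p = v"

lemma vpath_between_conv:
  "vpath_between G u p v \<longleftrightarrow> p \<noteq> [] \<and> hd p = u \<and> last p = v \<and> distinct p \<and>
     set p \<subseteq> verts G \<and> successively (dominates G) p"
  by (auto simp: vpath_between_def vpath_def vwalk_conv_successively)

lemma vpath_between_verts: "vpath_between G u p v \<Longrightarrow> u \<in> set p \<and> v \<in> set p"
  by (auto simp: vpath_between_conv)

lemma (in sym_digraph) dominates_sym: "u \<rightarrow> v \<Longrightarrow> v \<rightarrow> u"
  using sym_arcs by (rule arcs_ends_symmetric)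

lemma (in sym_digraph) dominates_commute: "u \<rightarrow> v \<longleftrightarrow> v \<rightarrow> u"
  using dominates_sym by blast

lemma (in sym_digraph) vpath_between_rev:
  "vpath_between G u p v \<Longrightarrow> vpath_between G v (rev p) u"
  using vwalk_rev_ex[OF sym_arcs]
  by (auto simp: vpath_between_def vpath_def hd_rev last_rev)

lemma (in loopfree_digraph) dominates_neq: "u \<rightarrow> v \<Longrightarrow> u \<noteq> v"
  using adj_not_same by blast

context wf_digraph
begin

lemma vwalk_imp_awalk:
  "vwalk p G \<Longrightarrow> \<exists>q. awalk (hd p) q (last p) \<and> awalk_verts (hd p) q = p"
proof (induction p rule: vwalk_arcs.induct)
  case (2 x)
  then show ?case by (intro exI[of _ "[]"]) (auto simp: awalk_simps vwalk_def)
next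
  case (3 x y xs)
  then have "(x, y) \<in> arcs_ends G" and w: "vwalk (y # xs) G"
    by auto
  then obtain e where e: "e \<in> arcs G" "tail G e = x" "head G e = y"
    by auto
  obtain q where "awalk y q (last (y # xs))" "awalk_verts y q = y # xs"
    using "3.IH"[OF w] by auto
  then show ?case
    using e by (intro exI[of _ "e # q"]) (auto simp: awalk_simps)
qed (simp add: vwalk_def)

lemma arc_edge_awalk:
  "awalk u p v \<Longrightarrow> arc_edge G ` set p = vwalk_edges (awalk_verts u p)"
proof (induction p arbitrary: u)
  case (Cons e p)
  then show ?case
    by (cases p) (auto simp: awalk_simps arc_edge_def)
qed simp

text \<open>The predicate sees both the vertices and the edges of the path, so that one transfer
  serves both kinds of colorings.\<close>

lemma ex_apath_iff_ex_vpath: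
  "(\<exists>p. apath u p v \<and> P (awalk_verts u p) (arc_edge G ` set p)) \<longleftrightarrow>
   (\<exists>p. vpath_between G u p v \<and> P p (vwalk_edges p))"
proof
  assume "\<exists>p. apath u p v \<and> P (awalk_verts u p) (arc_edge G ` set p)"
  then obtain p where p: "apath u p v" "P (awalk_verts u p) (arc_edge G ` set p)"
    by blast
  then have a: "awalk u p v" "distinct (awalk_verts u p)"
    by (auto simp: apath_def)
  then have "vpath_between G u (awalk_verts u p) v"
    unfolding vpath_between_def using awalk_imp_vwalk[OF a(1)] awalk_ends awalk_def
    by (auto simp: vpath_def awhd_if_cas awlast_if_cas)
  then show "\<exists>p. vpath_between G u p v \<and> P p (vwalk_edges p)"
    using p arc_edge_awalk[OF a(1)] by auto
next
  assume "\<exists>p. vpath_between G u p v \<and> P p (vwalk_edges p)"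
  then obtain p where p: "vpath_between G u p v" "P p (vwalk_edges p)"
    by blast
  then obtain q where q: "awalk u q v" "awalk_verts u q = p"
    using vwalk_imp_awalk[of p] by (auto simp: vpath_between_def vpath_def)
  then show "\<exists>p. apath u p v \<and> P (awalk_verts u p) (arc_edge G ` set p)"
    using p arc_edge_awalk[OF q(1)]
    by (auto simp: apath_def vpath_between_conv intro!: exI[of _ q])
qed

lemma cf_connected_conv:
  "cf_connected G c \<longleftrightarrow> (\<forall>u\<in>verts G. \<forall>v\<in>verts G. u \<noteq> v \<longrightarrow>
     (\<exists>p. vpath_between G u p v \<and> conflict_free c (vwalk_edges p)))"
  unfolding cf_connected_def using ex_apath_iff_ex_vpath[of _ _ "\<lambda>_. conflict_free c"] by simp

lemma cf_vertex_connected_conv: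
  "cf_vertex_connected G c \<longleftrightarrow> (\<forall>u\<in>verts G. \<forall>v\<in>verts G. u \<noteq> v \<longrightarrow>
     (\<exists>p. vpath_between G u p v \<and> conflict_free c (set p)))"
  unfolding cf_vertex_connected_def
  using ex_apath_iff_ex_vpath[of _ _ "\<lambda>p _. conflict_free c (set p)"] by simp

end

lemma edges_conv: "edges G = (\<lambda>(x, y). {x, y}) ` arcs_ends G"
  by (auto simp: edges_def arc_edge_def arcs_ends_conv image_image)

lemma (in sym_digraph) in_edges_iff: "{u, v} \<in> edges G \<longleftrightarrow> u \<rightarrow> v"
proof
  assume "{u, v} \<in> edges G"
  then show "u \<rightarrow> v"
    unfolding edges_conv by (auto simp: doubleton_eq_iff dest: dominates_sym)
qed (auto simp: edges_conv intro: image_eqI[of _ _ "(u, v)"])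

section \<open>Bounds on the least number of colors\<close>

lemma cfc_le:
  assumes "c ` edges G \<subseteq> {..<k}" "cf_connected G c"
  shows "cfc G \<le> k"
  unfolding cfc_def by (rule Least_le) (use assms in blast)

text \<open>One admissible coloring ensures that the \<open>LEAST\<close> is attained; a bound valid
  for all admissible colorings then applies to an optimal one.\<close>

lemma cfc_ge:
  assumes "c ` edges G \<subseteq> {..<k}" "cf_connected G c"
    and "\<And>c k. c ` edges G \<subseteq> {..<k} \<Longrightarrow> cf_connected G c \<Longrightarrow> n \<le> k"
  shows "n \<le> cfc G"
proof -
  have "\<exists>c. c ` edges G \<subseteq> {..<cfc G} \<and> cf_connected G c"
    unfolding cfc_def by (rule LeastI[where k = k]) (use assms(1,2) in blast)
  then show ?thesis using assms(3) by blast
qed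

lemma vcfc_eqI:
  assumes "c ` verts G \<subseteq> {..<k}" "cf_vertex_connected G c"
    and "\<And>c k'. c ` verts G \<subseteq> {..<k'} \<Longrightarrow> cf_vertex_connected G c \<Longrightarrow> k \<le> k'"
  shows "vcfc G = k"
  unfolding vcfc_def
proof (rule Least_equality)
  show "\<exists>c. c ` verts G \<subseteq> {..<k} \<and> cf_vertex_connected G c"
    using assms(1,2) by blast
qed (use assms(3) in blast)

section \<open>Connectedness and deletion of an edge\<close>

lemma (in sym_digraph) connected_iff_strongly_connected:
  "Digraph_Component.connected G \<longleftrightarrow> strongly_connected G"
  by (simp add: connected_def strongly_connected_def reachable_mk_symmetric_eq[OF sym_arcs])

lemma (in sym_digraph) strongly_connectedI_root:
  assumes "r \<in> verts G" "\<And>u. u \<in> verts G \<Longrightarrow> u \<rightarrow>\<^sup>* r"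
  shows "strongly_connected G"
proof (rule strongly_connectedI)
  fix u v assume "u \<in> verts G" "v \<in> verts G"
  then have "u \<rightarrow>\<^sup>* r" "r \<rightarrow>\<^sup>* v"
    using assms(2) symmetric_reachable' by blast+
  then show "u \<rightarrow>\<^sup>* v" by (rule reachable_trans)
qed (use assms(1) in blast)

lemma verts_delete_edge [simp]: "verts (delete_edge G e) = verts G"
  by (simp add: delete_edge_def)

lemma dominates_delete_edge: "u \<rightarrow>\<^bsub>delete_edge G e\<^esub> v \<longleftrightarrow> u \<rightarrow>\<^bsub>G\<^esub> v \<and> {u, v} \<noteq> e"
  by (auto simp: delete_edge_def arcs_ends_conv arc_edge_def image_iff)

lemma sym_digraph_delete_edge:
  assumes "sym_digraph G"
  shows "sym_digraph (delete_edge G e)"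
proof -
  interpret sym_digraph G by fact
  have "wf_digraph (delete_edge G e)"
    by (rule wf_digraph.intro) (simp_all add: delete_edge_def)
  moreover have "symmetric (delete_edge G e)"
    using dominates_sym by (auto simp: symmetric_def sym_def dominates_delete_edge insert_commute)
  ultimately show ?thesis by (rule wf_digraph.sym_digraphI)
qed

text \<open>If all vertices reached \<open>r\<close>, symmetry would join any two of them through
  \<open>r\<close>. The root is arbitrary, so each use can pick a convenient one.\<close>

lemma cut_edgesE:
  assumes "sym_digraph G" "r \<in> verts G" "e \<in> cut_edges G"
  obtains u where "u \<in> verts G" "\<not> u \<rightarrow>\<^sup>*\<^bsub>delete_edge G e\<^esub> r"
proof -
  interpret D: sym_digraph "delete_edge G e"
    using assms(1) by (rule sym_digraph_delete_edge)
  show thesis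
    using that D.strongly_connectedI_root[of r] assms D.connected_iff_strongly_connected
    by (auto simp: cut_edges_def)
qed

section \<open>Paths, colorings and cut-edges in diameter at most two\<close>

definition universal :: "('a, 'b) pre_digraph \<Rightarrow> 'a \<Rightarrow> bool" where
  "universal G v \<longleftrightarrow> v \<in> verts G \<and> (\<forall>u\<in>verts G. u \<noteq> v \<longrightarrow> u \<rightarrow>\<^bsub>G\<^esub> v)"

text \<open>The assumption expresses diameter at most two without distances; complete graphs satisfy
  it as well.\<close>

locale diameter_two_graph = graph +
  assumes two_step: "u \<in> verts G \<Longrightarrow> v \<in> verts G \<Longrightarrow> u \<noteq> v \<Longrightarrow> \<not> u \<rightarrow> v \<Longrightarrow> \<exists>w. u \<rightarrow> w \<and> w \<rightarrow> v"
begin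

lemma ex_vpath:
  assumes "u \<in> verts G" "v \<in> verts G"
  shows "\<exists>p. vpath_between G u p v"
proof -
  have "u \<rightarrow>\<^sup>* v"
    using assms two_step by (metis reachable_adjI reachable_refl reachable_trans)
  then show ?thesis by (auto simp: reachable_vpath_conv vpath_between_def)
qed

text \<open>All other vertices are joined, avoiding \<open>w\<close>, to a vertex at distance two from \<open>w\<close>.\<close>

lemma ex_vpath_avoiding:
  assumes w: "\<not> universal G w" and uv: "u \<in> verts G" "v \<in> verts G" "u \<noteq> w" "v \<noteq> w"
  shows "\<exists>p. vpath_between G u p v \<and> w \<notin> set p"
proof (cases "w \<in> verts G")
  case False
  then show ?thesis using ex_vpath[OF uv(1,2)] by (auto simp: vpath_between_conv)
next
  case True
  then obtain y where y: "y \<in> verts G" "y \<noteq> w" "\<not> y \<rightarrow> w"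
    using w by (auto simp: universal_def)
  interpret D: wf_digraph "del_vert w" by (rule wf_digraph_del_vert)
  have dom: "a \<rightarrow>\<^bsub>del_vert w\<^esub> b \<longleftrightarrow> a \<rightarrow> b \<and> a \<noteq> w \<and> b \<noteq> w" for a b
    by (auto simp: arcs_ends_conv del_vert_simps image_iff)
  interpret D: sym_digraph "del_vert w"
    using dominates_commute dom by unfold_locales (auto simp: symmetric_def sym_def)
  have reach: "a \<rightarrow>\<^sup>*\<^bsub>del_vert w\<^esub> y" if a: "a \<in> verts G" "a \<noteq> w" for a
  proof (cases "a = y \<or> a \<rightarrow> y")
    case True
    then show ?thesis using a y dom by (auto simp: del_vert_simps)
  next
    case False
    \<comment> \<open>The middle vertex \<open>b\<close> differs from \<open>w\<close>, because it
      is adjacent to \<open>y\<close> and \<open>w\<close> is not.\<close>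
    then obtain b where "a \<rightarrow> b" "b \<rightarrow> y" using two_step a y by blast
    then have "a \<rightarrow>\<^bsub>del_vert w\<^esub> b" "b \<rightarrow>\<^bsub>del_vert w\<^esub> y"
      using a y dom dominates_commute by auto
    then show ?thesis by (meson D.adj_reachable_trans D.reachable_adjI)
  qed
  have "u \<rightarrow>\<^sup>*\<^bsub>del_vert w\<^esub> v"
    using reach[of u] reach[of v] uv D.reachable_trans D.symmetric_reachable' by blast
  then obtain p where p: "vpath_between (del_vert w) u p v"
    by (auto simp: D.reachable_vpath_conv vpath_between_def)
  then have "vpath_between G u p v" "w \<notin> set p"
    using dom successively_mono[of "dominates (del_vert w)" p "dominates G"]
    by (auto simp: vpath_between_conv del_vert_simps)
  then show ?thesis by blast
qed

text \<open>If an end is adjacent to \<open>x\<close>, the path visits \<open>x\<close> next and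
  continues while avoiding that end. Otherwise both ends have paths of length two to
  \<open>x\<close>; these are joined at \<open>x\<close>, with a correction if their midpoints
  coincide.\<close>

lemma ex_vpath_through:
  assumes nu: "\<And>w. \<not> universal G w"
    and in_verts: "u \<in> verts G" "v \<in> verts G" "x \<in> verts G" and "u \<noteq> v" "u \<noteq> x" "v \<noteq> x"
  shows "\<exists>p. vpath_between G u p v \<and> x \<in> set p"
proof -
  have step: "\<exists>p. vpath_between G a p b \<and> x \<in> set p"
    if ab: "a \<in> verts G" "b \<in> verts G" "a \<noteq> b" "a \<noteq> x" "a \<rightarrow> x" for a b
  proof -
    obtain q where "vpath_between G x q b" "a \<notin> set q"
      using ex_vpath_avoiding[OF nu, of x b a] ab in_verts by auto
    then have "vpath_between G a (a # q) b" "x \<in> set (a # q)"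
      using ab by (auto simp: vpath_between_conv successively_Cons)
    then show ?thesis by blast
  qed
  consider "u \<rightarrow> x" | "v \<rightarrow> x" | "\<not> u \<rightarrow> x" "\<not> v \<rightarrow> x" by blast
  then show ?thesis
  proof cases
    case 1
    then show ?thesis using step assms by blast
  next
    case 2
    then obtain p where "vpath_between G v p u" "x \<in> set p" using step assms by blast
    then show ?thesis using vpath_between_rev by (intro exI[of _ "rev p"]) auto
  next
    case 3
    obtain a b where ab: "u \<rightarrow> a" "a \<rightarrow> x" "x \<rightarrow> b" "b \<rightarrow> v"
      using 3 two_step assms dominates_commute by metis
    note V = adj_in_verts[OF ab(1)] adj_in_verts[OF ab(4)]
    show ?thesis
    proof (cases "a = b")
      case False
      have "vpath_between G u [u, a, x, b, v] v"
        using ab 3 False V assms dominates_neq dominates_commute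
        by (auto simp: vpath_between_conv)
      then show ?thesis by fastforce
    next
      case True
      have av: "a \<rightarrow> v" "v \<rightarrow> a" "v \<noteq> a" "u \<noteq> a"
        using True ab 3 dominates_commute by auto
      \<comment> \<open>As the midpoint \<open>a\<close> is already used before \<open>x\<close>,
        the continuation from \<open>x\<close> must avoid it.\<close>
      obtain q where q: "vpath_between G x q v" "a \<notin> set q"
        using ex_vpath_avoiding[OF nu, of x v a] assms av ab dominates_neq by auto
      show ?thesis
      proof (cases "u \<in> set q")
        case False
        have "vpath_between G u (u # a # q) v" "x \<in> set (u # a # q)"
          using q False ab V av by (auto simp: vpath_between_conv successively_Cons)
        then show ?thesis by blast
      next
        \<comment> \<open>If the continuation runs into \<open>u\<close>, its part up to
          \<open>u\<close> misses \<open>v\<close>. Since \<open>a\<close> is also adjacent to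
          \<open>v\<close>, this part preceded by \<open>v\<close> and \<open>a\<close> is a path
          from \<open>v\<close> to \<open>u\<close>.\<close>
        case True
        then obtain q1 q2 where qq: "q = q1 @ u # q2" by (auto dest: split_list)
        then have "v \<notin> set (q1 @ [u])"
          using q \<open>u \<noteq> v\<close> by (cases q2 rule: rev_cases) (auto simp: vpath_between_conv)
        moreover have x: "vpath_between G x (q1 @ [u]) u"
          using q qq \<open>u \<noteq> x\<close>
          by (cases q1)
            (auto simp: vpath_between_conv successively_append_iff successively_Cons hd_append)
        ultimately have "vpath_between G v (v # a # q1 @ [u]) u"
          using q qq av ab V by (auto simp: vpath_between_conv successively_Cons)
        then have "vpath_between G u (rev (v # a # q1 @ [u])) v" by (rule vpath_between_rev)
        moreover have "x \<in> set (rev (v # a # q1 @ [u]))"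
          using vpath_between_verts[OF x] by auto
        ultimately show ?thesis by blast
      qed
    qed
  qed
qed

text \<open>
  A path through \<open>x\<close> that misses \<open>y\<close> is rerouted: the part between \<open>x\<close> and the first vertex of
  the path on a walk from \<open>y\<close> in the graph without \<open>x\<close> is replaced by that walk.
\<close>

lemma ex_vpath_through_edge:
  assumes nu: "\<And>w. \<not> universal G w"
    and in_verts: "u \<in> verts G" "v \<in> verts G" and "u \<noteq> v" and xy: "x \<rightarrow> y"
  shows "\<exists>p. vpath_between G u p v \<and> {x, y} \<in> vwalk_edges p"
proof -
  note V = adj_in_verts[OF xy] and neq = dominates_neq[OF xy]
  note yx = dominates_sym[OF xy]
  \<comment> \<open>From \<open>x\<close> the edge is taken first, followed by a path from
    \<open>y\<close> that avoids \<open>x\<close>.\<close>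
  have from_x: "\<exists>p. vpath_between G x p b \<and> {x, y} \<in> vwalk_edges p" if b: "b \<in> verts G" "b \<noteq> x" for b
  proof -
    obtain q where q: "vpath_between G y q b" "x \<notin> set q"
      using ex_vpath_avoiding[OF nu, of y b x] b V neq by auto
    then have "vpath_between G x (x # q) b"
      using xy V by (auto simp: vpath_between_conv successively_Cons)
    moreover have "{x, y} \<in> vwalk_edges (x # q)"
      using q by (cases q) (auto simp: vpath_between_conv)
    ultimately show ?thesis by blast
  qed
  consider "u = x" | "v = x" | "u \<noteq> x" "v \<noteq> x" by blast
  then show ?thesis
  proof cases
    case 1
    then show ?thesis using from_x assms by blast
  next
    case 2
    then obtain p where "vpath_between G v p u" "{x, y} \<in> vwalk_edges p"
      using from_x assms by blast
    then show ?thesis using vpath_between_rev by (intro exI[of _ "rev p"]) auto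
  next
    case 3
    then obtain p where p: "vpath_between G u p v" "x \<in> set p"
      using ex_vpath_through[OF nu, of u v x] assms V by auto
    then obtain A B where AB: "p = A @ x # B" by (auto dest: split_list)
    with p 3 have ne: "A \<noteq> []" "B \<noteq> []" by (auto simp: vpath_between_conv)
    have p': "vpath_between G u (A @ x # B) v" using p AB by simp
    \<comment> \<open>If the path visits \<open>y\<close>, the edge serves as a shortcut for the
      part between \<open>x\<close> and \<open>y\<close>.\<close>
    consider "y \<in> set A" | "y \<in> set B" | "y \<notin> set A" "y \<notin> set B" by blast
    then show ?thesis
    proof cases
      case 1
      then obtain A1 A2 where A: "A = A1 @ y # A2" by (auto dest: split_list)
      have "vpath_between G u (A1 @ y # x # B) v"
        using p' yx by (auto simp: A vpath_between_conv successively_append_iff successively_Cons hd_append)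
      then show ?thesis
        using consecutive_in_vwalk_edges[of y x A1 B] by (auto simp: insert_commute)
    next
      case 2
      then obtain B1 B2 where B: "B = B1 @ y # B2" by (auto dest: split_list)
      have "vpath_between G u (A @ x # y # B2) v"
        using p' xy by (auto simp: B vpath_between_conv successively_append_iff successively_Cons hd_append)
      then show ?thesis using consecutive_in_vwalk_edges by fast
    next
      case 3
      obtain q where q: "vpath_between G y q u" "x \<notin> set q"
        using ex_vpath_avoiding[OF nu, of y u x] in_verts V neq \<open>u \<noteq> x\<close> by auto
      \<comment> \<open>A path from \<open>y\<close> to \<open>u\<close> that avoids
        \<open>x\<close> ends on \<open>A\<close>, so it has a first vertex \<open>z\<close> on the
        old path. Its part \<open>Q1\<close> before \<open>z\<close> starts with \<open>y\<close>
        and is disjoint from \<open>A\<close> and \<open>B\<close>.\<close>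
      have "u \<in> set A" using p' ne by (cases A) (auto simp: vpath_between_conv)
      moreover have "u \<in> set q" using vpath_between_verts[OF q(1)] by blast
      ultimately have "\<exists>z\<in>set q. z \<in> set A \<union> set B" by blast
      then obtain Q1 z Q2 where Q: "q = Q1 @ z # Q2" "z \<in> set A \<union> set B"
        and Q1: "set Q1 \<inter> (set A \<union> set B) = {}"
        using split_list_first_propE[of q "\<lambda>z. z \<in> set A \<union> set B"] by (metis disjoint_iff)
      have hQ: "Q1 \<noteq> []" "hd Q1 = y"
        using q Q 3 by (cases Q1; auto simp: vpath_between_conv)+
      then obtain Q' where Q': "Q1 = y # Q'" by (cases Q1) auto
      have sQ: "successively (dominates G) (Q1 @ [z])" "distinct Q1" "x \<notin> set Q1" "set Q1 \<subseteq> verts G"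
        using q Q by (auto simp: vpath_between_conv successively_append_iff)
      from Q(2) show ?thesis
      proof
        assume "z \<in> set B"
        then obtain B1 B2 where B: "B = B1 @ z # B2" by (auto dest: split_list)
        have "vpath_between G u (A @ x # Q1 @ z # B2) v"
          using p' sQ Q1 hQ xy
          by (auto simp: B vpath_between_conv successively_append_iff successively_Cons hd_append)
        then show ?thesis
          using consecutive_in_vwalk_edges[of x y A "Q' @ z # B2"] by (auto simp: Q')
      next
        assume "z \<in> set A"
        then obtain A1 A2 where A: "A = A1 @ z # A2" by (auto dest: split_list)
        have "successively (dominates G) (rev (Q1 @ [z]))"
          unfolding successively_rev using sQ(1) dominates_sym by (auto intro: successively_mono)
        then have "vpath_between G u (A1 @ z # rev Q1 @ x # B) v"
          using p' sQ(2-) Q1 hQ yx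
          by (auto simp: A vpath_between_conv successively_append_iff successively_Cons hd_append
              hd_rev last_rev)
        moreover have "{x, y} \<in> vwalk_edges (A1 @ z # rev Q1 @ x # B)"
          using consecutive_in_vwalk_edges[of y x "A1 @ z # rev Q'" B] by (simp add: Q' insert_commute)
        ultimately show ?thesis by blast
      qed
    qed
  qed
qed

lemma ex_cf_connected_2_coloring:
  assumes nu: "\<And>w. \<not> universal G w" and "verts G \<noteq> {}"
  shows "\<exists>c. c ` edges G \<subseteq> {..<2} \<and> cf_connected G c"
proof -
  \<comment> \<open>An edge exists, since a vertex that is not universal and a vertex not adjacent
    to it have a common neighbor.\<close>
  obtain x y where xy: "x \<rightarrow> y"
    using assms dominates_commute two_step unfolding universal_def by (metis ex_in_conv)
  have "cf_connected G (\<lambda>e. if e = {x, y} then 1 else 0)"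
    unfolding cf_connected_conv
  proof (intro ballI impI)
    fix u v assume "u \<in> verts G" "v \<in> verts G" "u \<noteq> v"
    then obtain p where "vpath_between G u p v" "{x, y} \<in> vwalk_edges p"
      using ex_vpath_through_edge[OF nu _ _ _ xy] by blast
    moreover from this(2) have "conflict_free (\<lambda>e. if e = {x, y} then 1 else 0) (vwalk_edges p)"
      by (rule conflict_freeI) (auto split: if_splits)
    ultimately show "\<exists>p. vpath_between G u p v \<and>
        conflict_free (\<lambda>e. if e = {x, y} then 1 else 0) (vwalk_edges p)"
      by blast
  qed
  then show ?thesis by (intro exI[of _ "\<lambda>e. if e = {x, y} then 1 else 0"]) auto
qed

text \<open>The vertex with a color of its own is a universal one if there is any, and arbitrary
  otherwise.\<close>

lemma ex_cf_vertex_connected_2_coloring: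
  assumes "verts G \<noteq> {}"
  shows "\<exists>c. c ` verts G \<subseteq> {..<2} \<and> cf_vertex_connected G c"
proof -
  have "\<exists>x\<in>verts G. \<forall>u\<in>verts G. \<forall>v\<in>verts G. u \<noteq> v \<longrightarrow> u \<noteq> x \<longrightarrow> v \<noteq> x \<longrightarrow>
    (\<exists>p. vpath_between G u p v \<and> x \<in> set p)"
  proof (cases "\<exists>x. universal G x")
    case True
    then obtain x where x: "universal G x" by blast
    have "vpath_between G u [u, x, v] v"
      if "u \<in> verts G" "v \<in> verts G" "u \<noteq> v" "u \<noteq> x" "v \<noteq> x" for u v
      using that x dominates_commute by (auto simp: vpath_between_conv universal_def)
    then show ?thesis using x by (fastforce simp: universal_def)
  next
    case False
    then show ?thesis using assms ex_vpath_through by blast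
  qed
  then obtain x where x: "x \<in> verts G" and through: "\<forall>u\<in>verts G. \<forall>v\<in>verts G.
      u \<noteq> v \<longrightarrow> u \<noteq> x \<longrightarrow> v \<noteq> x \<longrightarrow> (\<exists>p. vpath_between G u p v \<and> x \<in> set p)" ..
  have "cf_vertex_connected G (\<lambda>z. if z = x then 1 else 0)"
    unfolding cf_vertex_connected_conv
  proof (intro ballI impI)
    fix u v assume uv: "u \<in> verts G" "v \<in> verts G" "u \<noteq> v"
    have "\<exists>p. vpath_between G u p v \<and> x \<in> set p"
    proof (cases "u = x \<or> v = x")
      case True
      obtain p where "vpath_between G u p v" using ex_vpath[OF uv(1,2)] ..
      with True show ?thesis using vpath_between_verts[of G u p v] by (intro exI[of _ p]) auto
    next
      case False
      then show ?thesis using through uv by simp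
    qed
    then obtain p where "vpath_between G u p v" "x \<in> set p" by blast
    moreover from this(2) have "conflict_free (\<lambda>z. if z = x then 1 else 0) (set p)"
      by (rule conflict_freeI) (auto split: if_splits)
    ultimately show "\<exists>p. vpath_between G u p v \<and>
        conflict_free (\<lambda>z. if z = x then 1 else 0) (set p)"
      by blast
  qed
  then show ?thesis by (intro exI[of _ "\<lambda>z. if z = x then 1 else 0"]) auto
qed

text \<open>Let \<open>y\<close> be at distance two from the end \<open>a\<close> of a cut-edge. All
  vertices other than \<open>a\<close> reach \<open>y\<close> without the edge, so \<open>a\<close>
  is cut off from them and \<open>b\<close> is its only neighbor. Diameter two then makes
  \<open>b\<close> universal.\<close>

lemma cut_edges_empty:
  assumes nu: "\<And>w. \<not> universal G w"
  shows "cut_edges G = {}"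
proof (rule ccontr)
  assume "cut_edges G \<noteq> {}"
  then obtain a b where ab: "{a, b} \<in> cut_edges G" "a \<rightarrow> b"
    by (fastforce simp: cut_edges_def edges_conv)
  let ?D = "delete_edge G {a, b}"
  interpret D: sym_digraph ?D
    using sym_digraph_axioms by (rule sym_digraph_delete_edge)
  note V = adj_in_verts[OF ab(2)] and neq = dominates_neq[OF ab(2)]
  obtain y where y: "y \<in> verts G" "y \<noteq> a" "\<not> y \<rightarrow> a"
    using nu[of a] V by (auto simp: universal_def)
  have "y \<noteq> b" using y ab dominates_commute by blast
  have reach: "p \<rightarrow>\<^sup>*\<^bsub>?D\<^esub> y" if p: "p \<in> verts G" "p \<noteq> a" for p
  proof (cases "p = y \<or> p \<rightarrow> y")
    case True
    then show ?thesis
      using p y \<open>y \<noteq> b\<close> D.reachable_adjI[of p y] by (auto simp: dominates_delete_edge doubleton_eq_iff)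
  next
    case False
    then obtain q where q: "p \<rightarrow> q" "q \<rightarrow> y" using two_step p y by blast
    \<comment> \<open>Paths of length at most two to \<open>y\<close> avoid \<open>a\<close>, and
      hence the deleted edge.\<close>
    then have "q \<noteq> a" using y dominates_commute by blast
    then have "p \<rightarrow>\<^bsub>?D\<^esub> q" "q \<rightarrow>\<^bsub>?D\<^esub> y"
      using q p y \<open>y \<noteq> b\<close> by (auto simp: dominates_delete_edge doubleton_eq_iff)
    then show ?thesis by (meson D.adj_reachable_trans D.reachable_adjI)
  qed
  obtain u where "u \<in> verts G" "\<not> u \<rightarrow>\<^sup>*\<^bsub>?D\<^esub> y"
    using cut_edgesE[OF sym_digraph_axioms y(1) ab(1)] by blast
  with reach have a: "\<not> a \<rightarrow>\<^sup>*\<^bsub>?D\<^esub> y" by blast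
  have leaf: "x = b" if "a \<rightarrow> x" for x
  proof (rule ccontr)
    assume "x \<noteq> b"
    with that have "a \<rightarrow>\<^bsub>?D\<^esub> x" by (auto simp: dominates_delete_edge doubleton_eq_iff)
    moreover have "x \<rightarrow>\<^sup>*\<^bsub>?D\<^esub> y"
      using that dominates_neq adj_in_verts by (intro reach) blast+
    ultimately show False using a D.adj_reachable_trans by blast
  qed
  \<comment> \<open>A path of length two from \<open>a\<close> has \<open>b\<close> as its
    midpoint.\<close>
  have "u \<rightarrow> b" if "u \<in> verts G" "u \<noteq> b" for u
    using two_step[of a u] that V leaf ab(2) dominates_commute by metis
  with V have "universal G b" by (auto simp: universal_def)
  with nu show False by blast
qed

end

section \<open>Graphs with a universal vertex\<close>

text \<open>The locale is instantiated twice: for the given graph and for the star of its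
  cut-edges.\<close>

locale universal_vertex_graph = graph +
  fixes v
  assumes universal: "universal G v"
begin

text \<open>Excluding \<open>v\<close> makes leaves correspond one to one to cut-edges, even if the
  graph is a single edge.\<close>

definition leaves :: "'a set" where
  "leaves = {u \<in> verts G. u \<noteq> v \<and> (\<forall>x. u \<rightarrow> x \<longrightarrow> x = v)}"

lemma universal_in_verts: "v \<in> verts G"
  using universal by (simp add: universal_def)

lemma adj_universal:
  assumes "u \<in> verts G" "u \<noteq> v"
  shows "u \<rightarrow> v" "v \<rightarrow> u"
  using universal assms dominates_sym by (auto simp: universal_def)

lemma finite_leaves: "finite leaves"
  by (simp add: leaves_def)

text \<open>A vertex \<open>u\<close> can be cut off from \<open>v\<close> only by deleting their
  common edge, and a further neighbor \<open>x\<close> of \<open>u\<close> would leave the detour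
  over \<open>x\<close>. Conversely, a leaf becomes isolated when its edge is deleted.\<close>

lemma in_cut_edges_iff: "e \<in> cut_edges G \<longleftrightarrow> (\<exists>u\<in>leaves. e = {u, v})"
proof
  assume e: "e \<in> cut_edges G"
  interpret D: sym_digraph "delete_edge G e"
    using sym_digraph_axioms by (rule sym_digraph_delete_edge)
  obtain u where u: "u \<in> verts G" "\<not> u \<rightarrow>\<^sup>*\<^bsub>delete_edge G e\<^esub> v"
    using cut_edgesE[OF sym_digraph_axioms universal_in_verts e] .
  have "u \<noteq> v" using u by auto
  then have e_def: "e = {u, v}"
    using u adj_universal D.reachable_adjI[of u v] by (auto simp: dominates_delete_edge)
  have "x = v" if x: "u \<rightarrow> x" for x
  proof (rule ccontr)
    assume "x \<noteq> v"
    then have "u \<rightarrow>\<^bsub>delete_edge G e\<^esub> x" "x \<rightarrow>\<^bsub>delete_edge G e\<^esub> v"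
      using x adj_universal(1)[of x] adj_in_verts(2)[OF x] dominates_neq[OF x] \<open>u \<noteq> v\<close>
      by (auto simp: dominates_delete_edge e_def doubleton_eq_iff)
    with u show False using D.adj_reachable_trans D.reachable_adjI by blast
  qed
  then show "\<exists>u\<in>leaves. e = {u, v}"
    using u \<open>u \<noteq> v\<close> e_def by (auto simp: leaves_def)
next
  assume "\<exists>u\<in>leaves. e = {u, v}"
  then obtain u where u: "u \<in> leaves" "e = {u, v}" by blast
  interpret D: sym_digraph "delete_edge G e"
    using sym_digraph_axioms by (rule sym_digraph_delete_edge)
  have uv: "u \<in> verts G" "u \<noteq> v" using u by (auto simp: leaves_def)
  have "\<not> u \<rightarrow>\<^sup>*\<^bsub>delete_edge G e\<^esub> v"
  proof
    assume "u \<rightarrow>\<^sup>*\<^bsub>delete_edge G e\<^esub> v"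
    then show False
      using uv u by (cases rule: pre_digraph.converse_reachable_cases)
        (auto simp: dominates_delete_edge leaves_def)
  qed
  then show "e \<in> cut_edges G"
    using uv universal_in_verts adj_universal u in_edges_iff D.connected_iff_strongly_connected
    by (auto simp: cut_edges_def strongly_connected_def)
qed

text \<open>
  Nonadjacent vertices are joined through \<open>v\<close> if their edges to \<open>v\<close> differ in color. If not,
  both edges have color 0, one of the two vertices has a neighbor outside \<open>leaves\<close> and
  different from \<open>v\<close>, and the detour over this neighbor contains color 1 exactly once.
\<close>

lemma ex_cf_connected_coloring:
  "\<exists>c. c ` edges G \<subseteq> {..<max 2 (card leaves)} \<and> cf_connected G c"
proof -
  obtain f :: "'a \<Rightarrow> nat" where f: "bij_betw f leaves {0..<card leaves}"
    using ex_bij_betw_finite_nat[OF finite_leaves] by blast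
  \<comment> \<open>Vertices that are not leaves share color 0 with one of the leaves, so they cost
    no additional color.\<close>
  define g where "g x = (if x \<in> leaves then f x else 0)" for x
  define c where "c e = (if v \<in> e then g (the_elem (e - {v})) else 1)" for e
  have c_v [simp]: "c {x, v} = g x" "c {v, x} = g x" if "x \<noteq> v" for x
  proof -
    have "{x, v} - {v} = {x}" "{v, x} - {v} = {x}" using that by auto
    then show "c {x, v} = g x" "c {v, x} = g x" by (simp_all add: c_def)
  qed
  have c_1 [simp]: "c {x, y} = 1" if "x \<noteq> v" "y \<noteq> v" for x y
    using that by (auto simp: c_def)
  have "g x < max 2 (card leaves)" for x
    using bij_betwE[OF f] by (auto simp: g_def less_max_iff_disj)
  then have range: "c ` edges G \<subseteq> {..<max 2 (card leaves)}"
    by (auto simp: c_def less_max_iff_disj)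
  have detour: "\<exists>p. vpath_between G u p w \<and> conflict_free c (vwalk_edges p)"
    if uw: "u \<in> verts G" "w \<in> verts G" "u \<noteq> w" "u \<noteq> v" "w \<noteq> v" "\<not> u \<rightarrow> w" "w \<notin> leaves" "g u = 0"
    for u w
  proof -
    obtain x where x: "w \<rightarrow> x" "x \<noteq> v"
      using uw by (auto simp: leaves_def)
    note V = adj_in_verts[OF x(1)]
    have xw: "x \<rightarrow> w" using x(1) by (rule dominates_sym)
    have "x \<notin> leaves" using xw uw by (auto simp: leaves_def)
    have ne: "x \<noteq> u" "x \<noteq> w" using xw uw dominates_neq by auto
    have "vpath_between G u [u, v, x, w] w"
      using uw x V ne xw adj_universal[of u] adj_universal[of x] universal_in_verts
      by (auto simp: vpath_between_conv)
    moreover have "conflict_free c (vwalk_edges [u, v, x, w])"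
      \<comment> \<open>The two edges at \<open>v\<close> have color 0 and the last edge has color
        1.\<close>
      by (rule conflict_freeI[of "{x, w}"])
        (use uw x \<open>x \<notin> leaves\<close> in \<open>auto simp: g_def[of x]\<close>)
    ultimately show ?thesis by blast
  qed
  have "cf_connected G c"
    unfolding cf_connected_conv
  proof (intro ballI impI)
    fix u w assume uw: "u \<in> verts G" "w \<in> verts G" "u \<noteq> w"
    consider "u \<rightarrow> w" | "\<not> u \<rightarrow> w" "g u \<noteq> g w" | "\<not> u \<rightarrow> w" "g u = g w" by blast
    then show "\<exists>p. vpath_between G u p w \<and> conflict_free c (vwalk_edges p)"
    proof cases
      case 1
      then have "vpath_between G u [u, w] w" "conflict_free c (vwalk_edges [u, w])"
        using uw by (auto simp: vpath_between_conv intro: conflict_freeI)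
      then show ?thesis by blast
    next
      case 2
      then have ne: "u \<noteq> v" "w \<noteq> v" using uw adj_universal by blast+
      then have "vpath_between G u [u, v, w] w"
        using uw adj_universal universal_in_verts by (auto simp: vpath_between_conv)
      moreover have "conflict_free c (vwalk_edges [u, v, w])"
        by (rule conflict_freeI[of "{u, v}"]) (use ne 2 in auto)
      ultimately show ?thesis by blast
    next
      case 3
      then have ne: "u \<noteq> v" "w \<noteq> v" using uw adj_universal by blast+
      \<comment> \<open>Leaves have pairwise distinct colors, so one of the two vertices is not a
        leaf and the common color is 0.\<close>
      have "\<not> (u \<in> leaves \<and> w \<in> leaves)"
        using inj_onD[OF bij_betw_imp_inj_on[OF f], of u w] 3(2) \<open>u \<noteq> w\<close> by (auto simp: g_def)
      then consider "w \<notin> leaves" "g u = 0" | "u \<notin> leaves" "g w = 0"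
        using 3(2) unfolding g_def by presburger
      then show ?thesis
      proof cases
        case 1
        then show ?thesis using detour uw ne 3 by blast
      next
        case 2
        then obtain p where "vpath_between G w p u" "conflict_free c (vwalk_edges p)"
          using detour[of w u] uw ne 3 dominates_sym by blast
        then show ?thesis using vpath_between_rev by (intro exI[of _ "rev p"]) auto
      qed
    qed
  qed
  with range show ?thesis by blast
qed

text \<open>The only path between two leaves runs through \<open>v\<close> and has two edges, which
  must differ in color.\<close>

lemma card_leaves_le:
  assumes "c ` edges G \<subseteq> {..<k}" and cf: "cf_connected G c"
  shows "card leaves \<le> k"
proof -
  have "inj_on (\<lambda>u. c {u, v}) leaves"
  proof (rule inj_onI, rule ccontr)
    fix u w assume uw: "u \<in> leaves" "w \<in> leaves" "c {u, v} = c {w, v}" "u \<noteq> w"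
    then have "u \<in> verts G" "w \<in> verts G" by (simp_all add: leaves_def)
    then obtain p where p: "vpath_between G u p w" "conflict_free c (vwalk_edges p)"
      using cf \<open>u \<noteq> w\<close> unfolding cf_connected_conv by blast
    have L: "u \<noteq> v" "w \<noteq> v" "\<And>x. u \<rightarrow> x \<Longrightarrow> x = v" "\<And>x. x \<rightarrow> w \<Longrightarrow> x = v"
      using uw dominates_commute by (auto simp: leaves_def)
    obtain p1 where p1: "p = u # p1 @ [w]"
      using p(1) uw
      by (cases p; cases "tl p" rule: rev_cases) (auto simp: vpath_between_conv)
    \<comment> \<open>Both ends of the path have \<open>v\<close> as their only neighbor, so its
      interior starts and ends with \<open>v\<close>; distinctness leaves just
      \<open>v\<close>.\<close>
    have "hd p1 = v" "last p1 = v" "p1 \<noteq> []"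
      using p(1) L
      by (cases p1; auto simp: p1 vpath_between_conv successively_Cons successively_append_iff)+
    moreover have "distinct p1" using p(1) by (auto simp: p1 vpath_between_conv)
    ultimately have "p1 = [v]"
      by (cases p1) (auto split: if_splits)
    then have edges: "vwalk_edges p = {{u, v}, {w, v}}"
      by (auto simp: p1 insert_commute)
    have "{u, v} \<noteq> {w, v}"
      using \<open>u \<noteq> w\<close> L(1) by (auto simp: doubleton_eq_iff)
    then show False
      using p(2) uw(3) unfolding conflict_free_def edges by (metis insertCI insertE singletonD)
  qed
  then have "card leaves = card ((\<lambda>u. c {u, v}) ` leaves)"
    by (simp add: card_image)
  also have "\<dots> \<le> card {..<k}"
  proof (rule card_mono)
    have "{u, v} \<in> edges G" if "u \<in> leaves" for u
      using that adj_universal(1) by (simp add: in_edges_iff leaves_def)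
    then show "(\<lambda>u. c {u, v}) ` leaves \<subseteq> {..<k}" using assms(1) by blast
  qed simp
  finally show ?thesis by simp
qed

text \<open>The upper bound need not be attained: a single edge needs only one color. The bounds do
  determine \<open>max 2 (cfc G)\<close>.\<close>

lemma cfc_bounds: "card leaves \<le> cfc G" "cfc G \<le> max 2 (card leaves)"
proof -
  obtain c where c: "c ` edges G \<subseteq> {..<max 2 (card leaves)}" "cf_connected G c"
    using ex_cf_connected_coloring by blast
  then show "cfc G \<le> max 2 (card leaves)" by (rule cfc_le)
  show "card leaves \<le> cfc G" using c card_leaves_le by (rule cfc_ge)
qed

text \<open>This makes \<open>cfc_bounds\<close> available for the star, with the same number of
  leaves. Without leaves the union of the cut-edges would be empty and \<open>v\<close> would not
  belong to it.\<close>

lemma cut_edge_subgraph_star: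
  assumes "leaves \<noteq> {}"
  shows "universal_vertex_graph (cut_edge_subgraph G) v"
    and "universal_vertex_graph.leaves (cut_edge_subgraph G) v = leaves"
proof -
  let ?C = "cut_edge_subgraph G"
  have V: "verts ?C = insert v leaves"
  proof -
    have "cut_edges G = (\<lambda>u. {u, v}) ` leaves"
      using in_cut_edges_iff by blast
    then show ?thesis using assms by (auto simp: cut_edge_subgraph_def)
  qed
  have dom: "a \<rightarrow>\<^bsub>?C\<^esub> b \<longleftrightarrow> a \<in> leaves \<and> b = v \<or> a = v \<and> b \<in> leaves" for a b
  proof -
    have "a \<rightarrow>\<^bsub>?C\<^esub> b \<longleftrightarrow> a \<rightarrow> b \<and> {a, b} \<in> cut_edges G"
      by (auto simp: cut_edge_subgraph_def arcs_ends_conv arc_edge_def image_iff)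
    also have "\<dots> \<longleftrightarrow> {a, b} \<in> cut_edges G"
      using in_edges_iff by (auto simp: cut_edges_def)
    also have "\<dots> \<longleftrightarrow> a \<in> leaves \<and> b = v \<or> a = v \<and> b \<in> leaves"
      by (auto simp: in_cut_edges_iff doubleton_eq_iff)
    finally show ?thesis .
  qed
  have "wf_digraph ?C"
    by (rule wf_digraph.intro) (auto simp: cut_edge_subgraph_def arc_edge_def intro: UnionI)
  then have "subgraph ?C G"
    using universal_in_verts wf_digraph_axioms V
    by (auto simp: subgraph_def compatible_def leaves_def cut_edge_subgraph_def)
  then have "digraph ?C" by (rule digraph_subgraph)
  moreover have "symmetric ?C"
    using dom by (auto simp: symmetric_def sym_def)
  ultimately have "graph ?C" by (rule digraph.graphI)
  moreover have "universal ?C v"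
    using dom V by (auto simp: universal_def)
  ultimately show C: "universal_vertex_graph ?C v"
    by (simp add: universal_vertex_graph_def universal_vertex_graph_axioms_def)
  show "universal_vertex_graph.leaves ?C v = leaves"
    unfolding universal_vertex_graph.leaves_def[OF C] using V dom by (auto simp: leaves_def)
qed

text \<open>The star is connected and thus the only component, so the maximum in
  \<open>cut_edge_cfc\<close> ranges over one value. Without leaves both sides are 2.\<close>

lemma max_cut_edge_cfc: "max 2 (cut_edge_cfc G) = max 2 (card leaves)"
proof (cases "leaves = {}")
  case True
  then have "cut_edges G = {}" using in_cut_edges_iff by blast
  with True show ?thesis by (simp add: cut_edge_cfc_def)
next
  case False
  interpret C: universal_vertex_graph "cut_edge_subgraph G" v
    using False by (rule cut_edge_subgraph_star)
  have "strongly_connected (cut_edge_subgraph G)"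
  proof (rule C.strongly_connectedI_root[OF C.universal_in_verts])
    fix u assume "u \<in> verts (cut_edge_subgraph G)"
    then show "u \<rightarrow>\<^sup>*\<^bsub>cut_edge_subgraph G\<^esub> v"
      using C.adj_universal(1)[of u] C.reachable_adjI[of u v] C.reachable_refl[of u] by blast
  qed
  then have "C.sccs = {cut_edge_subgraph G}"
    by (simp add: C.strongly_connected_eq_iff)
  moreover have "cut_edges G \<noteq> {}"
    using False in_cut_edges_iff by blast
  ultimately have "cut_edge_cfc G = cfc (cut_edge_subgraph G)"
    by (simp add: cut_edge_cfc_def)
  then show ?thesis
    using C.cfc_bounds cut_edge_subgraph_star(2)[OF False] by simp
qed

end

section \<open>Consequences of the diameter, lower bounds and conclusion\<close>

lemma (in wf_digraph) awalk_cost_one: "awalk_cost (\<lambda>_. 1) p = length p"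
  by (induction p) auto

lemma (in graph) diameter_two_imp_two_step:
  assumes "diameter G \<le> 2" "u \<in> verts G" "v \<in> verts G" "u \<noteq> v" "\<not> u \<rightarrow> v"
  shows "\<exists>w. u \<rightarrow> w \<and> w \<rightarrow> v"
proof -
  have "\<mu> (\<lambda>_. 1) u v \<le> diameter G"
    unfolding diameter_def using assms(2,3) by (meson SUP_upper SUP_upper2)
  \<comment> \<open>The distance is an infimum over walks; a strict bound yields an actual walk
    below it, here of length at most two.\<close>
  also have "\<dots> < 3" using assms(1) by (rule le_less_trans) simp
  finally have "\<mu> (\<lambda>_. 1) u v < 3" .
  then obtain p where p: "awalk u p v" "length p < 3"
    by (auto simp: \<mu>_def INF_less_iff awalk_cost_one)
  have "p \<noteq> []" "\<nexists>e. p = [e]"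
    using p assms by (auto simp: awalk_simps dest: in_arcs_imp_in_arcs_ends)
  with p(2) obtain e f where "p = [e, f]"
    by (cases p; cases "tl p"; cases "tl (tl p)") auto
  with p(1) show ?thesis
    by (auto simp: awalk_simps dest: in_arcs_imp_in_arcs_ends intro!: exI[of _ "head G e"])
qed

text \<open>Such a pair forces two colors in both versions. If there were none, walks of at most one
  arc would bound all distances by 1.\<close>

lemma (in graph) diameter_gt_one_imp_nonadjacent:
  assumes "\<not> diameter G \<le> 1"
  shows "\<exists>u\<in>verts G. \<exists>v\<in>verts G. u \<noteq> v \<and> \<not> u \<rightarrow> v"
proof (rule ccontr)
  assume *: "\<not> ?thesis"
  have "\<mu> (\<lambda>_. 1) u v \<le> 1" if uv: "u \<in> verts G" "v \<in> verts G" for u v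
  proof -
    have "\<exists>p. awalk u p v \<and> length p \<le> 1"
    proof (cases "u = v")
      case True
      then show ?thesis using uv by (intro exI[of _ "[]"]) (auto simp: awalk_simps)
    next
      case False
      then obtain e where "e \<in> arcs G" "tail G e = u" "head G e = v"
        using * uv by (metis reachableE)
      then show ?thesis using uv by (intro exI[of _ "[e]"]) (auto simp: awalk_simps)
    qed
    then obtain p where p: "awalk u p v" "length p \<le> 1" by blast
    have "\<mu> (\<lambda>_. 1) u v \<le> awalk_cost (\<lambda>_. 1) p" using p(1) by (rule min_cost_le_walk_cost)
    also have "\<dots> \<le> 1" using p(2) by (simp add: awalk_cost_one)
    finally show ?thesis .
  qed
  then have "diameter G \<le> 1" unfolding diameter_def by (intro SUP_least)
  with assms show False by blast
qed

lemma (in wf_digraph) vcfc_coloring_ge_2: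
  assumes "u \<in> verts G" "v \<in> verts G" "u \<noteq> v"
    and c: "c ` verts G \<subseteq> {..<k}" "cf_vertex_connected G c"
  shows "2 \<le> k"
proof (rule ccontr)
  assume "\<not> 2 \<le> k"
  then have const: "c x = 0" if "x \<in> verts G" for x
    using c(1) that by fastforce
  obtain p where p: "vpath_between G u p v" "conflict_free c (set p)"
    using assms unfolding cf_vertex_connected_conv by blast
  have "u \<in> set p" "v \<in> set p" "set p \<subseteq> verts G"
    using vpath_between_verts[OF p(1)] p(1) by (auto simp: vpath_between_conv)
  then show False
    using p(2) const \<open>u \<noteq> v\<close> unfolding conflict_free_def by (metis subsetD)
qed

text \<open>A path between nonadjacent vertices has at least two edges, so a single color would
  repeat on it.\<close>

lemma (in sym_digraph) cfc_coloring_ge_2: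
  assumes "u \<in> verts G" "v \<in> verts G" "u \<noteq> v" "\<not> u \<rightarrow> v"
    and c: "c ` edges G \<subseteq> {..<k}" "cf_connected G c"
  shows "2 \<le> k"
proof (rule ccontr)
  assume "\<not> 2 \<le> k"
  then have const: "c e = 0" if "e \<in> edges G" for e
    using c(1) that by fastforce
  obtain p where p: "vpath_between G u p v" "conflict_free c (vwalk_edges p)"
    using assms unfolding cf_connected_conv by blast
  obtain x y q where q: "p = u # x # y # q"
    using p(1) assms(3,4)
    by (cases p; cases "tl p"; cases "tl (tl p)") (auto simp: vpath_between_conv)
  have sub: "vwalk_edges p \<subseteq> edges G"
    using p(1) by (auto simp: vpath_between_def vpath_def vwalk_def vwalk_edges_def edges_conv)
  have "{u, x} \<in> vwalk_edges p" "{x, y} \<in> vwalk_edges p" by (auto simp: q)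
  moreover have "{u, x} \<noteq> {x, y}"
    using p(1) by (auto simp: q vpath_between_conv doubleton_eq_iff)
  ultimately show False
    using p(2) const sub unfolding conflict_free_def by (metis subsetD)
qed

theorem theorem3p7:
  fixes G :: "('a, 'b) pre_digraph"
  assumes "graph G"
    and "Digraph_Component.connected G"
    and "diameter G = 2"
  shows "vcfc G = 2 \<and> cfc G = max 2 (cut_edge_cfc G)"
proof -
  interpret graph G by fact
  interpret diameter_two_graph G
    by unfold_locales (use diameter_two_imp_two_step assms(3) in simp)
  obtain a b where ab: "a \<in> verts G" "b \<in> verts G" "a \<noteq> b" "\<not> a \<rightarrow>\<^bsub>G\<^esub> b"
    using diameter_gt_one_imp_nonadjacent assms(3) by auto
  then have ne: "verts G \<noteq> {}" by blast
  have "vcfc G = 2"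
  proof -
    obtain c where "c ` verts G \<subseteq> {..<2}" "cf_vertex_connected G c"
      using ex_cf_vertex_connected_2_coloring[OF ne] by blast
    then show ?thesis by (rule vcfc_eqI) (rule vcfc_coloring_ge_2[OF ab(1-3)])
  qed
  moreover have "cfc G = max 2 (cut_edge_cfc G)"
  proof (cases "\<exists>v. universal G v")
    case True
    then obtain v where "universal G v" ..
    then interpret universal_vertex_graph G v by unfold_locales
    \<comment> \<open>With fewer than two leaves \<open>cfc_bounds\<close> gives a weaker lower
      bound; the nonadjacent pair supplies 2.\<close>
    have "2 \<le> cfc G"
    proof -
      obtain c where "c ` edges G \<subseteq> {..<max 2 (card leaves)}" "cf_connected G c"
        using ex_cf_connected_coloring by blast
      then show ?thesis by (rule cfc_ge) (rule cfc_coloring_ge_2[OF ab])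
    qed
    then show ?thesis using cfc_bounds max_cut_edge_cfc by simp
  next
    case False
    then have nu: "\<not> universal G w" for w by blast
    obtain c where c: "c ` edges G \<subseteq> {..<2}" "cf_connected G c"
      using ex_cf_connected_2_coloring[OF nu ne] by blast
    have "cfc G \<le> 2" using c by (rule cfc_le)
    moreover have "2 \<le> cfc G" using c by (rule cfc_ge) (rule cfc_coloring_ge_2[OF ab])
    \<comment> \<open>Without cut-edges \<open>cut_edge_cfc G\<close> is 0, and the maximum is
      2.\<close>
    ultimately show ?thesis using cut_edges_empty[OF nu] by (simp add: cut_edge_cfc_def)
  qed
  ultimately show ?thesis ..
qed

end
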